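(* Let $G=(V,E)$ be a finite graph with maximum degree at most $\Delta$. Then $C(I_2(G))\leq \left\lceil\frac{\Delta+1}{2}\right\rceil$.
   Context: Graphs are finite, simple and undirected. For a graph $G=(V,E)$ and an integer $n\geq 1$, $I_n(G)$ is the simplicial complex $\{U\subseteq V:\ \alpha(G[U])<n\}$, where $\alpha$ is the independence number; so $I_2(G)$ is the clique complex of $G$. For a finite simplicial complex $X$, a face $\sigma$ contained in a unique maximal face $\tau$ is a free face; if $|\sigma|\leq d$, removing all faces $\eta$ with $\sigma\subseteq\eta\subseteq\tau$ is an elementary $d$-collapse. $X$ is $d$-collapsible if a sequence of elementary $d$-collapses reduces it to the void complex (no faces at all). $C(X)$ is the minimum $d$ such that $X$ is $d$-collapsible. *)

theory Defs
  imports Complex_Main "HOL-Library.Ramsey"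
begin

section \<open>Finite simple graphs\<close>

text \<open>A graph is a vertex set \<open>V\<close> with an edge set \<open>E\<close> of two-element subsets of \<open>V\<close>;
  independent sets are those of \<^const>\<open>indep\<close> from the Ramsey theory.\<close>

definition finite_simple_graph :: "'a set \<Rightarrow> 'a set set \<Rightarrow> bool" where
  "finite_simple_graph V E \<longleftrightarrow> finite V \<and> E \<subseteq> nsets V 2"

definition degree :: "'a set \<Rightarrow> 'a set set \<Rightarrow> 'a \<Rightarrow> nat" where
  "degree V E v = card {w \<in> V. {v, w} \<in> E}"

text \<open>The inserted \<open>0\<close> only matters for the graph without vertices.\<close>

definition max_degree :: "'a set \<Rightarrow> 'a set set \<Rightarrow> nat" where
  "max_degree V E = Max (insert 0 (degree V E ` V))"

definition independence_number :: "'a set \<Rightarrow> 'a set set \<Rightarrow> nat" where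
  "independence_number V E = Max {card S | S. S \<subseteq> V \<and> indep S E}"

definition induced_edges :: "'a set set \<Rightarrow> 'a set \<Rightarrow> 'a set set" where
  "induced_edges E U = {e \<in> E. e \<subseteq> U}"

definition independence_complex :: "nat \<Rightarrow> 'a set \<Rightarrow> 'a set set \<Rightarrow> 'a set set" where
  "independence_complex n V E =
     {U. U \<subseteq> V \<and> independence_number U (induced_edges E U) < n}"


section \<open>Collapsibility of finite simplicial complexes\<close>

text \<open>A complex is its set of faces. The empty set is a face of every complex other than the
  void complex \<open>{}\<close>.\<close>

definition simplicial_complex :: "'a set set \<Rightarrow> bool" where
  "simplicial_complex X \<longleftrightarrow>
     finite X \<and> (\<forall>\<tau>\<in>X. finite \<tau>) \<and> (\<forall>\<tau>\<in>X. \<forall>\<sigma>. \<sigma> \<subseteq> \<tau> \<longrightarrow> \<sigma> \<in> X)"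

definition maximal_face :: "'a set set \<Rightarrow> 'a set \<Rightarrow> bool" where
  "maximal_face X \<tau> \<longleftrightarrow> \<tau> \<in> X \<and> (\<forall>\<eta>\<in>X. \<tau> \<subseteq> \<eta> \<longrightarrow> \<eta> = \<tau>)"

text \<open>A free face may itself be maximal, and it may be the empty face (when the complex is a
  simplex); without these cases the void complex could not be reached.\<close>

definition free_face :: "'a set set \<Rightarrow> 'a set \<Rightarrow> bool" where
  "free_face X \<sigma> \<longleftrightarrow> \<sigma> \<in> X \<and> (\<exists>!\<tau>. maximal_face X \<tau> \<and> \<sigma> \<subseteq> \<tau>)"

definition elementary_collapse :: "nat \<Rightarrow> 'a set set \<Rightarrow> 'a set set \<Rightarrow> bool" where
  "elementary_collapse d X Y \<longleftrightarrow>
     (\<exists>\<sigma> \<tau>. free_face X \<sigma> \<and> maximal_face X \<tau> \<and> \<sigma> \<subseteq> \<tau> \<and> card \<sigma> \<le> d \<and>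
            Y = X - {\<eta>. \<sigma> \<subseteq> \<eta> \<and> \<eta> \<subseteq> \<tau>})"

definition d_collapsible :: "nat \<Rightarrow> 'a set set \<Rightarrow> bool" where
  "d_collapsible d X \<longleftrightarrow> (elementary_collapse d)\<^sup>*\<^sup>* X {}"

definition collapsibility :: "'a set set \<Rightarrow> nat" where
  "collapsibility X = (LEAST d. d_collapsible d X)"

text \<open>The minimum is over a nonempty set, so \<^const>\<open>collapsibility\<close> is attained.\<close>

lemma d_collapsible_if_card_le:
  assumes "finite X" "\<And>\<tau>. \<tau> \<in> X \<Longrightarrow> card \<tau> \<le> d"
  shows "d_collapsible d X"
  using assms
proof (induction "card X" arbitrary: X)
  case 0
  then show ?case by (simp add: d_collapsible_def)
next
  case (Suc k)
  then have "X \<noteq> {}" by auto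
  then obtain \<tau> where \<tau>: "\<tau> \<in> X" "\<And>\<eta>. \<eta> \<in> X \<Longrightarrow> \<tau> \<subseteq> \<eta> \<Longrightarrow> \<eta> = \<tau>"
    using finite_has_maximal[OF Suc.prems(1)] by metis
  then have max: "maximal_face X \<tau>" by (auto simp: maximal_face_def)
  have "free_face X \<tau>"
    unfolding free_face_def using \<tau> max by (auto simp: maximal_face_def)
  moreover have "X - {\<tau>} = X - {\<eta>. \<tau> \<subseteq> \<eta> \<and> \<eta> \<subseteq> \<tau>}" by auto
  ultimately have "elementary_collapse d X (X - {\<tau>})"
    unfolding elementary_collapse_def using max Suc.prems(2)[OF \<tau>(1)] by blast
  moreover have "d_collapsible d (X - {\<tau>})"
    using Suc.hyps(2) Suc.prems \<tau>(1) by (intro Suc.hyps(1)) auto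
  ultimately show ?case
    unfolding d_collapsible_def by (rule converse_rtranclp_into_rtranclp)
qed

lemma d_collapsible_collapsibility:
  assumes "simplicial_complex X"
  shows "d_collapsible (collapsibility X) X"
proof -
  have "d_collapsible (Max (card ` X)) X"
    using assms by (intro d_collapsible_if_card_le) (auto simp: simplicial_complex_def)
  then show ?thesis unfolding collapsibility_def by (rule LeastI)
qed

lemma independence_number_induced_less_iff:
  assumes "finite U" "n \<ge> 1"
  shows "independence_number U (induced_edges E U) < n \<longleftrightarrow>
         (\<forall>S. S \<subseteq> U \<and> indep S E \<longrightarrow> card S < n)"
proof -
  have ind: "indep S (induced_edges E U) \<longleftrightarrow> indep S E" if "S \<subseteq> U" for S
    unfolding indep_def induced_edges_def using that by blast
  have eq: "{card S | S. S \<subseteq> U \<and> indep S (induced_edges E U)} =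
      card ` {S. S \<subseteq> U \<and> indep S E}"
    using ind by blast
  have "finite {S. S \<subseteq> U \<and> indep S E}" using assms(1) by simp
  moreover have "{} \<in> {S. S \<subseteq> U \<and> indep S E}" by (simp add: indep_def)
  ultimately show ?thesis
    unfolding independence_number_def eq by (subst Max_less_iff) auto
qed

lemma simplicial_complex_independence_complex:
  assumes "finite_simple_graph V E" "n \<ge> 1"
  shows "simplicial_complex (independence_complex n V E)"
proof -
  have V: "finite V" using assms by (simp add: finite_simple_graph_def)
  have mem: "U \<in> independence_complex n V E \<longleftrightarrow>
      U \<subseteq> V \<and> (\<forall>S. S \<subseteq> U \<and> indep S E \<longrightarrow> card S < n)" for U
    using independence_number_induced_less_iff[OF finite_subset[OF _ V] assms(2)]
    by (auto simp: independence_complex_def)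
  have sub: "independence_complex n V E \<subseteq> Pow V" by (auto simp: mem)
  then have "finite (independence_complex n V E)" using V by (meson finite_Pow_iff finite_subset)
  moreover have "\<forall>\<tau>\<in>independence_complex n V E. finite \<tau>"
    using sub V finite_subset by blast
  moreover have "\<forall>\<tau>\<in>independence_complex n V E. \<forall>\<sigma>. \<sigma> \<subseteq> \<tau> \<longrightarrow> \<sigma> \<in> independence_complex n V E"
    using mem by (meson subset_trans)
  ultimately show ?thesis unfolding simplicial_complex_def by blast
qed

lemma independence_complex_2_eq_cliques:
  assumes "finite_simple_graph V E"
  shows "independence_complex 2 V E = {U. U \<subseteq> V \<and> clique U E}"
proof -
  have V: "finite V" using assms by (simp add: finite_simple_graph_def)
  have "(\<forall>S. S \<subseteq> U \<and> indep S E \<longrightarrow> card S < 2) \<longleftrightarrow> clique U E" if "U \<subseteq> V" for U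
  proof
    assume *: "\<forall>S. S \<subseteq> U \<and> indep S E \<longrightarrow> card S < 2"
    show "clique U E" unfolding clique_def
    proof (intro ballI impI)
      fix v w assume "v \<in> U" "w \<in> U" "v \<noteq> w"
      then show "{v, w} \<in> E"
        using *[rule_format, of "{v, w}"] by (auto simp: indep_def insert_commute)
    qed
  next
    assume cl: "clique U E"
    show "\<forall>S. S \<subseteq> U \<and> indep S E \<longrightarrow> card S < 2"
    proof (intro allI impI)
      fix S assume S: "S \<subseteq> U \<and> indep S E"
      then have "\<forall>v\<in>S. \<forall>w\<in>S. v = w" using cl unfolding clique_def indep_def by blast
      moreover have "finite S" using S that V by (meson finite_subset)
      ultimately have "card S \<le> 1" by (auto simp: card_le_Suc0_iff_eq)
      then show "card S < 2" by simp
    qed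
  qed
  then show ?thesis
    using independence_number_induced_less_iff[OF finite_subset[OF _ V], of _ 2]
    by (auto simp: independence_complex_def)
qed

end

theory Submission
  imports Defs
begin

text \<open>Splitting off a vertex \<open>v\<close> of a complex \<open>X\<close> gives
  \<open>C(X) \<le> max (C(X - v)) (C(lk v) + 1)\<close>: a collapse of the link, joined with \<open>v\<close>, removes every
  face through \<open>v\<close>. In the clique complex of a graph the link of \<open>v\<close> is the clique complex of its
  neighbourhood. A clique complex on \<open>n\<close> vertices has \<open>C \<le> n/2\<close>: if some vertex has a non-neighbour
  then its link has at most \<open>n - 2\<close> vertices, and otherwise the complex is a cone, whose apex can
  be dropped. Hence all links have \<open>C \<le> \<lfloor>\<Delta>/2\<rfloor>\<close>, and removing the vertices one at a time gives
  \<open>C \<le> \<lfloor>\<Delta>/2\<rfloor> + 1 = \<lceil>(\<Delta> + 1)/2\<rceil>\<close>.\<close>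

section \<open>Collapses through a vertex: links and cones\<close>

lemma elementary_collapse_subset: "elementary_collapse d X Y \<Longrightarrow> Y \<subseteq> X"
  unfolding elementary_collapse_def by blast

lemma d_collapsible_mono:
  assumes "d_collapsible d X" "d \<le> d'"
  shows "d_collapsible d' X"
proof -
  have "elementary_collapse d \<le> elementary_collapse d'"
    using assms(2) unfolding elementary_collapse_def by (blast intro: le_trans)
  then show ?thesis
    using assms(1) rtranclp_mono unfolding d_collapsible_def by blast
qed

lemma image_Diff_eq: "(\<And>x. x \<in> A \<Longrightarrow> f x \<in> T \<longleftrightarrow> x \<in> S) \<Longrightarrow> f ` (A - S) = f ` A - T"
  by blast

text \<open>No set in \<open>A\<close> can contain \<open>insert v T\<close>, and
  \<open>insert v\<close> preserves and reflects inclusion on sets avoiding \<open>v\<close>. Since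
  \<open>A\<close> is arbitrary, this serves both the link and the cone
  (\<open>A = L\<close>).\<close>

lemma maximal_face_link_iff:
  assumes A: "\<And>U. U \<in> A \<Longrightarrow> v \<notin> U" and L: "\<And>U. U \<in> L \<Longrightarrow> v \<notin> U" and T: "T \<in> L"
  shows "maximal_face (A \<union> insert v ` L) (insert v T) \<longleftrightarrow> maximal_face L T"
proof -
  have "\<not> insert v T \<subseteq> U" if "U \<in> A" for U using A[OF that] by blast
  moreover have "insert v T \<subseteq> insert v U \<longleftrightarrow> T \<subseteq> U"
    "insert v U = insert v T \<longleftrightarrow> U = T" if "U \<in> L" for U
    using L[OF that] L[OF T] by (simp_all add: subset_insert insert_ident)
  ultimately show ?thesis
    unfolding maximal_face_def ball_Un using T by (simp del: insert_subset)
qed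

text \<open>The interval from \<sigma> to \<tau> is lifted by \<open>insert v\<close>, which leaves
  \<open>A\<close> untouched. The free face gains the vertex \<open>v\<close>, hence
  \<open>Suc d\<close>.\<close>

lemma elementary_collapse_link:
  assumes "elementary_collapse d L L'"
    and A: "\<And>U. U \<in> A \<Longrightarrow> v \<notin> U" and L: "\<And>U. U \<in> L \<Longrightarrow> v \<notin> U"
  shows "elementary_collapse (Suc d) (A \<union> insert v ` L) (A \<union> insert v ` L')"
proof -
  obtain \<sigma> \<tau> where fr: "free_face L \<sigma>" and mx: "maximal_face L \<tau>" and sub: "\<sigma> \<subseteq> \<tau>"
    and card: "card \<sigma> \<le> d" and L': "L' = L - {\<eta>. \<sigma> \<subseteq> \<eta> \<and> \<eta> \<subseteq> \<tau>}"
    using assms(1) unfolding elementary_collapse_def by blast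
  let ?X = "A \<union> insert v ` L"
  have \<sigma>\<tau>: "\<sigma> \<in> L" "\<tau> \<in> L"
    using fr mx by (auto simp: free_face_def maximal_face_def)
  have uniq: "T = insert v \<tau>" if T: "maximal_face ?X T" "insert v \<sigma> \<subseteq> T" for T
  proof -
    have "T \<in> ?X" using T(1) by (simp add: maximal_face_def)
    moreover have "T \<notin> A" using T(2) A by blast
    ultimately obtain T' where T': "T' \<in> L" "T = insert v T'" by blast
    have "maximal_face L T'"
      using T(1) maximal_face_link_iff[OF A L T'(1)] by (simp add: T'(2))
    moreover have "\<sigma> \<subseteq> T'"
      using T(2) L[OF \<sigma>\<tau>(1)] by (simp add: T'(2) subset_insert)
    ultimately show ?thesis
      using fr mx sub T'(2) unfolding free_face_def by blast
  qed
  have mx': "maximal_face ?X (insert v \<tau>)"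
    using mx maximal_face_link_iff[OF A L \<sigma>\<tau>(2)] by simp
  have "free_face ?X (insert v \<sigma>)"
    unfolding free_face_def
  proof
    show "insert v \<sigma> \<in> ?X" using \<sigma>\<tau> by blast
    show "\<exists>!T. maximal_face ?X T \<and> insert v \<sigma> \<subseteq> T"
    proof (rule ex1I)
      show "maximal_face ?X (insert v \<tau>) \<and> insert v \<sigma> \<subseteq> insert v \<tau>" using mx' sub by blast
    qed (use uniq in blast)
  qed
  moreover have "card (insert v \<sigma>) \<le> Suc d"
    \<comment> \<open>For infinite \<sigma> the cardinality of \<open>insert v \<sigma>\<close> is 0
      by default.\<close>
    using card by (cases "finite \<sigma>") (auto simp: card_insert_if)
  moreover have "A \<union> insert v ` L' = ?X - {\<eta>. insert v \<sigma> \<subseteq> \<eta> \<and> \<eta> \<subseteq> insert v \<tau>}"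
  proof -
    have "insert v ` L' = insert v ` L - {\<eta>. insert v \<sigma> \<subseteq> \<eta> \<and> \<eta> \<subseteq> insert v \<tau>}"
      unfolding L' using L \<sigma>\<tau>(1) by (intro image_Diff_eq) (simp add: subset_insert)
    moreover have "A - {\<eta>. insert v \<sigma> \<subseteq> \<eta> \<and> \<eta> \<subseteq> insert v \<tau>} = A" using A by blast
    ultimately show ?thesis by (simp only: Un_Diff)
  qed
  moreover have "insert v \<sigma> \<subseteq> insert v \<tau>" using sub by blast
  ultimately show ?thesis
    unfolding elementary_collapse_def using mx' by (intro exI conjI)
qed

text \<open>Induction along the collapse of \<open>L\<close>, with \<open>A\<close> fixed: once the
  link is void, exactly \<open>A\<close> is left.\<close>

lemma d_collapsible_link:
  assumes "d_collapsible d L" "d_collapsible (Suc d) A"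
    and "\<And>U. U \<in> A \<Longrightarrow> v \<notin> U" "\<And>U. U \<in> L \<Longrightarrow> v \<notin> U"
  shows "d_collapsible (Suc d) (A \<union> insert v ` L)"
  using assms(1)[unfolded d_collapsible_def] assms(4)
proof (induction rule: converse_rtranclp_induct)
  case base
  then show ?case using assms(2) by simp
next
  case (step L L')
  have "elementary_collapse (Suc d) (A \<union> insert v ` L) (A \<union> insert v ` L')"
    using elementary_collapse_link[OF step.hyps(1) assms(3) step.prems] .
  moreover have "d_collapsible (Suc d) (A \<union> insert v ` L')"
    using step.IH step.prems elementary_collapse_subset[OF step.hyps(1)] by blast
  ultimately show ?case
    unfolding d_collapsible_def by (rule converse_rtranclp_into_rtranclp)
qed

text \<open>Every maximal face of a cone contains the apex, so \<sigma> stays free without receiving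
  \<open>v\<close>. The interval from \<sigma> to \<open>insert v \<tau>\<close> removes both copies
  of each face at once, and the size bound stays \<open>d\<close>.\<close>

lemma elementary_collapse_cone:
  assumes "elementary_collapse d A B" and A: "\<And>U. U \<in> A \<Longrightarrow> v \<notin> U"
  shows "elementary_collapse d (A \<union> insert v ` A) (B \<union> insert v ` B)"
proof -
  obtain \<sigma> \<tau> where fr: "free_face A \<sigma>" and mx: "maximal_face A \<tau>" and sub: "\<sigma> \<subseteq> \<tau>"
    and card: "card \<sigma> \<le> d" and B: "B = A - {\<eta>. \<sigma> \<subseteq> \<eta> \<and> \<eta> \<subseteq> \<tau>}"
    using assms(1) unfolding elementary_collapse_def by blast
  let ?X = "A \<union> insert v ` A"
  have \<sigma>\<tau>: "\<sigma> \<in> A" "\<tau> \<in> A"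
    using fr mx by (auto simp: free_face_def maximal_face_def)
  have uniq: "T = insert v \<tau>" if T: "maximal_face ?X T" "\<sigma> \<subseteq> T" for T
  proof -
    have "T \<in> ?X" using T(1) by (simp add: maximal_face_def)
    \<comment> \<open>A face in \<open>A\<close> is properly contained in its own cone face, so it
      is not maximal.\<close>
    moreover have "T \<notin> A" using T(1) A unfolding maximal_face_def by blast
    ultimately obtain T' where T': "T' \<in> A" "T = insert v T'" by blast
    have "maximal_face A T'"
      using T(1) maximal_face_link_iff[OF A A T'(1)] by (simp add: T'(2))
    moreover have "\<sigma> \<subseteq> T'"
      using T(2) A[OF \<sigma>\<tau>(1)] T'(2) by blast
    ultimately show ?thesis
      using fr mx sub T'(2) unfolding free_face_def by blast
  qed
  have mx': "maximal_face ?X (insert v \<tau>)"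
    using mx maximal_face_link_iff[OF A A \<sigma>\<tau>(2)] by simp
  have "free_face ?X \<sigma>"
    unfolding free_face_def
  proof
    show "\<sigma> \<in> ?X" using \<sigma>\<tau> by blast
    show "\<exists>!T. maximal_face ?X T \<and> \<sigma> \<subseteq> T"
    proof (rule ex1I)
      show "maximal_face ?X (insert v \<tau>) \<and> \<sigma> \<subseteq> insert v \<tau>" using mx' sub by blast
    qed (use uniq in blast)
  qed
  moreover have "B \<union> insert v ` B = ?X - {\<eta>. \<sigma> \<subseteq> \<eta> \<and> \<eta> \<subseteq> insert v \<tau>}"
  proof -
    have "insert v ` B = insert v ` A - {\<eta>. \<sigma> \<subseteq> \<eta> \<and> \<eta> \<subseteq> insert v \<tau>}"
      unfolding B using A \<sigma>\<tau>(1) by (intro image_Diff_eq) (simp add: subset_insert)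
    moreover have "B = A - {\<eta>. \<sigma> \<subseteq> \<eta> \<and> \<eta> \<subseteq> insert v \<tau>}"
      unfolding B using A by (auto simp: subset_insert)
    ultimately show ?thesis by (metis Un_Diff)
  qed
  moreover have "\<sigma> \<subseteq> insert v \<tau>" using sub by blast
  ultimately show ?thesis
    unfolding elementary_collapse_def using mx' card by (intro exI conjI)
qed

lemma d_collapsible_cone:
  assumes "d_collapsible d A" "\<And>U. U \<in> A \<Longrightarrow> v \<notin> U"
  shows "d_collapsible d (A \<union> insert v ` A)"
  using assms(1)[unfolded d_collapsible_def] assms(2)
proof (induction rule: converse_rtranclp_induct)
  case base
  then show ?case by (simp add: d_collapsible_def)
next
  case (step A B)
  have "elementary_collapse d (A \<union> insert v ` A) (B \<union> insert v ` B)"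
    using elementary_collapse_cone[OF step.hyps(1) step.prems] .
  moreover have "d_collapsible d (B \<union> insert v ` B)"
    using step.IH step.prems elementary_collapse_subset[OF step.hyps(1)] by blast
  ultimately show ?case
    unfolding d_collapsible_def by (rule converse_rtranclp_into_rtranclp)
qed

text \<open>The start of the vertex inductions: without vertices the clique complex is
  \<open>{{}}\<close>, not void. Its only face has size 0, so \<open>d = 0\<close> suffices.\<close>

lemma d_collapsible_singleton_empty: "d_collapsible d {{}}"
  by (intro d_collapsible_if_card_le) auto

section \<open>Clique complexes and vertex neighbourhoods\<close>

definition clique_complex :: "'a set \<Rightarrow> 'a set set \<Rightarrow> 'a set set" where
  "clique_complex V E = {U. U \<subseteq> V \<and> clique U E}"

text \<open>Removing \<open>v\<close> explicitly keeps the link free of \<open>v\<close> for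
  arbitrary \<open>E\<close>, even if \<open>E\<close> contains the singleton
  \<open>{v}\<close>.\<close>

definition neighbours :: "'a set \<Rightarrow> 'a set set \<Rightarrow> 'a \<Rightarrow> 'a set" where
  "neighbours V E v = {w \<in> V - {v}. {v, w} \<in> E}"

lemma clique_complex_empty: "clique_complex {} E = {{}}"
  by (auto simp: clique_complex_def clique_def)

text \<open>This is the deletion of \<open>v\<close> together with its link, in the shape used for
  the link and cone collapses. \<open>E\<close> can stay the same on smaller vertex sets, because
  \<open>clique\<close> inspects only pairs inside the face.\<close>

lemma clique_complex_split:
  assumes "v \<in> V"
  shows "clique_complex V E =
    clique_complex (V - {v}) E \<union> insert v ` clique_complex (neighbours V E v) E" (is "?L = ?R")
proof
  show "?L \<subseteq> ?R"
  proof
    fix U assume U: "U \<in> ?L"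
    show "U \<in> ?R"
    proof (cases "v \<in> U")
      case False
      then show ?thesis using U by (auto simp: clique_complex_def)
    next
      case True
      then have "U = insert v (U - {v})" by blast
      moreover have "U - {v} \<in> clique_complex (neighbours V E v) E"
        using U True by (auto simp: clique_complex_def neighbours_def clique_def)
      ultimately show ?thesis by blast
    qed
  qed
  show "?R \<subseteq> ?L"
    using assms by (auto simp: clique_complex_def neighbours_def clique_def insert_commute)
qed

lemma d_collapsible_clique_complex_split:
  assumes "v \<in> V" "d_collapsible d (clique_complex (neighbours V E v) E)"
    and "d_collapsible (Suc d) (clique_complex (V - {v}) E)"
  shows "d_collapsible (Suc d) (clique_complex V E)"
  unfolding clique_complex_split[OF assms(1)]
  using assms(2,3)
  by (rule d_collapsible_link) (auto simp: clique_complex_def neighbours_def)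

lemma d_collapsible_clique_complex_card:
  assumes "finite V"
  shows "d_collapsible (card V div 2) (clique_complex V E)"
  using assms
\<comment> \<open>The hypothesis must cover both \<open>V - {v}\<close> and the neighbourhood of
  \<open>v\<close>, so all proper subsets are allowed.\<close>
proof (induction V rule: finite_psubset_induct)
  case (psubset V)
  show ?case
  proof (cases "V = {}")
    case True
    then show ?thesis by (simp add: clique_complex_empty d_collapsible_singleton_empty)
  next
    case False
    then obtain v where v: "v \<in> V" by blast
    have IH: "d_collapsible (card (V - {v}) div 2) (clique_complex (V - {v}) E)"
      using v by (intro psubset.IH) blast
    show ?thesis
    proof (cases "neighbours V E v = V - {v}")
      case True
      have "d_collapsible (card (V - {v}) div 2) (clique_complex V E)"
        unfolding clique_complex_split[OF v] True
        using IH by (rule d_collapsible_cone) (auto simp: clique_complex_def)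
      then show ?thesis
        by (rule d_collapsible_mono) (simp add: card_Diff1_le div_le_mono)
    next
      case False
      let ?N = "neighbours V E v"
      have N: "?N \<subset> V - {v}" using False by (auto simp: neighbours_def)
      then have "card ?N < card (V - {v})" using psubset.hyps by (simp add: psubset_card_mono)
      \<comment> \<open>Both \<open>v\<close> and a non-neighbour of it are missing from
        \<open>?N\<close>. Halving turns this loss of two into the one dimension that the link
        costs, and ensures that \<open>card V div 2 - 1\<close> is not truncated.\<close>
      then have card: "card ?N + 2 \<le> card V" using v psubset.hyps by simp
      have "d_collapsible (card ?N div 2) (clique_complex ?N E)"
        using N by (intro psubset.IH) blast
      then have "d_collapsible (card V div 2 - 1) (clique_complex ?N E)"
        by (rule d_collapsible_mono) (use card in linarith)
      moreover have "d_collapsible (Suc (card V div 2 - 1)) (clique_complex (V - {v}) E)"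
        using IH by (rule d_collapsible_mono) (use v psubset.hyps in simp)
      ultimately have "d_collapsible (Suc (card V div 2 - 1)) (clique_complex V E)"
        by (rule d_collapsible_clique_complex_split[OF v])
      then show ?thesis using card by simp
    qed
  qed
qed

text \<open>The bound \<Delta> is kept fixed while vertices are deleted, since neighbourhoods only
  shrink. Each link is controlled by its vertex count alone.\<close>

lemma d_collapsible_clique_complex_degree:
  assumes "finite V" "\<And>v. v \<in> V \<Longrightarrow> card (neighbours V E v) \<le> \<Delta>"
  shows "d_collapsible (Suc (\<Delta> div 2)) (clique_complex V E)"
  using assms
proof (induction V rule: finite_induct)
  case empty
  then show ?case by (simp add: clique_complex_empty d_collapsible_singleton_empty)
next
  case (insert v V)
  let ?W = "insert v V"
  have fin: "finite (neighbours ?W E w)" for w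
    using insert.hyps by (simp add: neighbours_def)
  have "d_collapsible (card (neighbours ?W E v) div 2) (clique_complex (neighbours ?W E v) E)"
    using fin by (rule d_collapsible_clique_complex_card)
  then have link: "d_collapsible (\<Delta> div 2) (clique_complex (neighbours ?W E v) E)"
    by (rule d_collapsible_mono) (simp add: insert.prems div_le_mono)
  have "card (neighbours V E w) \<le> \<Delta>" if "w \<in> V" for w
  proof -
    have "card (neighbours V E w) \<le> card (neighbours ?W E w)"
      by (intro card_mono fin) (auto simp: neighbours_def)
    then show ?thesis using insert.prems[of w] that by simp
  qed
  then have "d_collapsible (Suc (\<Delta> div 2)) (clique_complex (?W - {v}) E)"
    using insert.IH insert.hyps by simp
  with link show ?case by (rule d_collapsible_clique_complex_split[OF insertI1])
qed

theorem theorem1p7: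
  fixes V :: "'a set" and E :: "'a set set" and \<Delta> :: nat
  assumes "finite_simple_graph V E"
    and "max_degree V E \<le> \<Delta>"
  shows "int (collapsibility (independence_complex 2 V E)) \<le> \<lceil>(real \<Delta> + 1) / 2\<rceil>"
proof -
  have fin: "finite V" using assms(1) by (simp add: finite_simple_graph_def)
  have "card (neighbours V E v) \<le> \<Delta>" if "v \<in> V" for v
  proof -
    have "card (neighbours V E v) \<le> degree V E v"
      unfolding degree_def using fin by (intro card_mono) (auto simp: neighbours_def)
    also have "\<dots> \<le> max_degree V E"
      unfolding max_degree_def using fin that by (intro Max_ge) auto
    finally show ?thesis using assms(2) by simp
  qed
  then have "d_collapsible (Suc (\<Delta> div 2)) (independence_complex 2 V E)"
    using d_collapsible_clique_complex_degree[OF fin]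
    by (simp add: independence_complex_2_eq_cliques[OF assms(1)] clique_complex_def)
  then have "collapsibility (independence_complex 2 V E) \<le> Suc (\<Delta> div 2)"
    unfolding collapsibility_def by (rule Least_le)
  \<comment> \<open>By \<open>le_ceiling_iff\<close> this amounts to \<open>\<Delta> div 2\<close>
    being strictly below \<open>(\<Delta> + 1) / 2\<close>, which holds for both parities.\<close>
  moreover have "int (Suc (\<Delta> div 2)) \<le> \<lceil>(real \<Delta> + 1) / 2\<rceil>"
    by (simp add: le_ceiling_iff)
  ultimately show ?thesis by linarith
qed

end
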